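(* Let $f:\mathbb{R}^d\to\mathbb{R}$ be an $L$-smooth convex function having a minimizer $x_\star$, and let $f_\star=f(x_\star)$. Let $\tau_k=\frac{(k+2)+12}{12}$ and $\alpha_k=\frac12\frac{(\tau_{k+1}-1)^2}{\tau_k^2}$ (formulas used for integers $k\ge-1$), and let $B_0=\alpha_0^2\tau_0^2\left(\frac{(\tau_0-1)^2}{\alpha_{-1}\tau_{-1}^2}-1\right)$. With $A_k,B_k$ defined from these as in the context, let $r>0$ be a constant such that $$\left(\frac{A_k}{B_k}+\frac{B_{k+1}+\alpha_{k+1}^2\tau_{k+1}^2}{A_k}\right)^{-1}\ge\frac{r}{\alpha_{k+1}}\qquad\text{for all }k\ge0.$$ Let $x_0\ne\tilde x_0$ and $L_0=\|\nabla f(x_0)-\nabla f(\tilde x_0)\|/\|x_0-\tilde x_0\|>0$, set $s_0=\frac{A_0}{\alpha_0\tau_0}\frac{r}{\alpha_1}\frac1{L_0}$, and let $$R=\|x_0-x_\star\|^2+\left(s_0^2(B_0+\alpha_0^2\tau_0^2)-\frac{s_0\alpha_0\tau_0}{2L}\right)\|\nabla f(x_0)\|^2 .$$ Then the sequences generated by AdaNAG-G (defined in the context) with these parameters satisfy $$f(x_k)-f_\star\le\frac1{s_{k+1}}\,\frac{144(k+15)}{(k+3)(k+4)^2}\,R=\mathcal{O}\left(\frac L{k^2}\right),\qquad\min_{i\in\{1,\dots,k\}}\|\nabla f(x_i)\|^2=\mathcal{O}\left(\frac{L^2}{k^3}\right).$$ Here $s_k\ge\frac1{250}\frac1L$ and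 $\liminf_{k\to\infty}s_k\ge\frac13\frac1L$.
   Context: $f$ is $L$-smooth ($L>0$) if it is differentiable and $\nabla f$ is $L$-Lipschitz. AdaNAG-G with parameters $\{\tau_k\},\{\alpha_k\},B_0>0$: put $A_{-1}=0$, $A_k=\alpha_{k+1}\tau_{k+1}(\tau_{k+1}-1)$ for $k\ge0$, and $B_k=\alpha_k^2\tau_k^2\left(\frac{(\tau_k-1)^2}{\alpha_{k-1}\tau_{k-1}^2}-1\right)$ for $k\ge1$. Given $x_0=z_0\in\mathbb{R}^d$ and $s_0>0$, for $k=0,1,2,\dots$: $$y_{k+1}=x_k-s_k\nabla f(x_k),\quad z_{k+1}=z_k-s_k\alpha_k\tau_k\nabla f(x_k),\quad x_{k+1}=\left(1-\tfrac1{\tau_{k+1}}\right)y_{k+1}+\tfrac1{\tau_{k+1}}z_{k+1},$$ $$L_{k+1}=-\frac{\frac12\|\nabla f(x_{k+1})-\nabla f(x_k)\|^2}{f(x_{k+1})-f(x_k)+\langle\nabla f(x_{k+1}),x_k-x_{k+1}\rangle},$$ $$s_{k+1}=\min\left\{\frac{A_{k-1}+\alpha_k\tau_k}{A_k}s_k,\ \left(\frac{A_k}{B_k}+\frac{B_{k+1}+\alpha_{k+1}^2\tau_{k+1}^2}{A_k}\right)^{-1}\frac1{L_{k+1}}\right\}.$$ Conventions: $\frac00=0$ and $\frac a0=+\infty$ for $a>0$. The resulting algorithm is named AdaNAG-G$_{12}$.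
   Formalization: The bound s_k ≥ 1/(250L) is proved only when (A_0/(α_0τ_0))(r/α_1) ≥ 1/250, i.e. r ≥ 3/8750; for smaller admissible r it fails already at k=0 (f quadratic with L_0 = L), and all other claims hold for every admissible r. *)

theory Defs
  imports "HOL-Analysis.Analysis"
begin

definition gradient :: "('a::euclidean_space \<Rightarrow> real) \<Rightarrow> 'a \<Rightarrow> 'a" where
  "gradient f x = (THE D. GDERIV f x :> D)"

definition L_smooth :: "real \<Rightarrow> ('a::euclidean_space \<Rightarrow> real) \<Rightarrow> bool" where
  "L_smooth L f \<longleftrightarrow> L > 0 \<and> (\<forall>x. f differentiable (at x)) \<and> L-lipschitz_on UNIV (gradient f)"

text \<open>
  The parameter sequences are indexed by integers, since the index -1 is used:
  for A by convention, for \<open>\<tau>\<close> and \<open>\<alpha>\<close> in the initial value of B.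
\<close>

definition adanag_A :: "(int \<Rightarrow> real) \<Rightarrow> (int \<Rightarrow> real) \<Rightarrow> int \<Rightarrow> real" where
  "adanag_A \<tau> \<alpha> k = (if k < 0 then 0 else \<alpha> (k + 1) * \<tau> (k + 1) * (\<tau> (k + 1) - 1))"

definition adanag_B :: "(int \<Rightarrow> real) \<Rightarrow> (int \<Rightarrow> real) \<Rightarrow> real \<Rightarrow> int \<Rightarrow> real" where
  "adanag_B \<tau> \<alpha> B0 k =
     (if k \<le> 0 then B0
      else (\<alpha> k)\<^sup>2 * (\<tau> k)\<^sup>2 * ((\<tau> k - 1)\<^sup>2 / (\<alpha> (k - 1) * (\<tau> (k - 1))\<^sup>2) - 1))"

definition adanag_coeff :: "(int \<Rightarrow> real) \<Rightarrow> (int \<Rightarrow> real) \<Rightarrow> real \<Rightarrow> int \<Rightarrow> real" where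
  "adanag_coeff \<tau> \<alpha> B0 k =
     inverse (adanag_A \<tau> \<alpha> k / adanag_B \<tau> \<alpha> B0 k
       + (adanag_B \<tau> \<alpha> B0 (k + 1) + (\<alpha> (k + 1))\<^sup>2 * (\<tau> (k + 1))\<^sup>2) / adanag_A \<tau> \<alpha> k)"

text \<open>
  The local smoothness estimate along a step from \<open>u\<close> to \<open>v\<close>. Division on \<^typ>\<open>ereal\<close> satisfies
  \<open>0 / 0 = 0\<close> and \<open>a / 0 = \<infinity>\<close> for \<open>a > 0\<close>, which are the conventions wanted both here and for
  the reciprocal of the estimate in the step size rule below.
\<close>

definition local_L :: "('a::euclidean_space \<Rightarrow> real) \<Rightarrow> 'a \<Rightarrow> 'a \<Rightarrow> ereal" where
  "local_L f u v =
     - (ereal (1 / 2 * (norm (gradient f v - gradient f u))\<^sup>2)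
        / ereal (f v - f u + gradient f v \<bullet> (u - v)))"

text \<open>
  \<open>adanag_G f \<tau> \<alpha> B0 x y z s\<close>: the sequences are generated by the algorithm from \<open>x 0\<close> and \<open>s 0\<close>.
  The value \<open>y 0\<close> is irrelevant. The step size is real; only the minimum defining it
  is taken in \<^typ>\<open>ereal\<close>, its second argument being \<open>\<infinity>\<close> when the estimate is 0.
\<close>

definition adanag_G ::
  "('a::euclidean_space \<Rightarrow> real) \<Rightarrow> (int \<Rightarrow> real) \<Rightarrow> (int \<Rightarrow> real) \<Rightarrow> real
    \<Rightarrow> (nat \<Rightarrow> 'a) \<Rightarrow> (nat \<Rightarrow> 'a) \<Rightarrow> (nat \<Rightarrow> 'a) \<Rightarrow> (nat \<Rightarrow> real) \<Rightarrow> bool" where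
  "adanag_G f \<tau> \<alpha> B0 x y z s \<longleftrightarrow>
     z 0 = x 0 \<and>
     (\<forall>k::nat.
        y (k + 1) = x k - s k *\<^sub>R gradient f (x k) \<and>
        z (k + 1) = z k - (s k * \<alpha> (int k) * \<tau> (int k)) *\<^sub>R gradient f (x k) \<and>
        x (k + 1) = (1 - 1 / \<tau> (int k + 1)) *\<^sub>R y (k + 1) + (1 / \<tau> (int k + 1)) *\<^sub>R z (k + 1) \<and>
        ereal (s (k + 1)) =
          min (ereal ((adanag_A \<tau> \<alpha> (int k - 1) + \<alpha> (int k) * \<tau> (int k)) / adanag_A \<tau> \<alpha> (int k) * s k))
              (ereal (adanag_coeff \<tau> \<alpha> B0 (int k)) * (1 / local_L f (x k) (x (k + 1)))))"

definition tau12 :: "int \<Rightarrow> real" where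
  "tau12 k = ((of_int k + 2) + 12) / 12"

definition alpha12 :: "int \<Rightarrow> real" where
  "alpha12 k = 1 / 2 * ((tau12 (k + 1) - 1)\<^sup>2 / (tau12 k)\<^sup>2)"

definition B0_12 :: real where
  "B0_12 = (alpha12 0)\<^sup>2 * (tau12 0)\<^sup>2 * ((tau12 0 - 1)\<^sup>2 / (alpha12 (-1) * (tau12 (-1))\<^sup>2) - 1)"

definition R12 :: "('a::euclidean_space \<Rightarrow> real) \<Rightarrow> real \<Rightarrow> real \<Rightarrow> 'a \<Rightarrow> 'a \<Rightarrow> real" where
  "R12 f L s0 x0 xstar =
     (norm (x0 - xstar))\<^sup>2
     + (s0\<^sup>2 * (B0_12 + (alpha12 0)\<^sup>2 * (tau12 0)\<^sup>2) - s0 * alpha12 0 * tau12 0 / (2 * L))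
       * (norm (gradient f x0))\<^sup>2"

end

theory Submission
  imports Defs "HOL-Real_Asymp.Real_Asymp"
begin

text \<open>
  With \<open>g\<^sub>k\<close> the gradient at \<open>x\<^sub>k\<close> and \<open>a\<^sub>k = \<alpha>\<^sub>k \<tau>\<^sub>k\<close>, where \<open>B\<^sub>k = a\<^sub>k\<^sup>2\<close> for these parameters, the energy
  \<open>s\<^sub>k\<^sub>+\<^sub>1 A\<^sub>k (f x\<^sub>k - f x\<^sub>\<star>) + 1/2 \<parallel>z\<^sub>k\<^sub>+\<^sub>1 - x\<^sub>\<star>\<parallel>\<^sup>2 + 1/2 B\<^sub>k s\<^sub>k\<^sup>2 \<parallel>g\<^sub>k\<parallel>\<^sup>2\<close> starts below \<open>R / 2\<close>
  and decreases by at least \<open>1/2 A\<^sub>k s\<^sub>k s\<^sub>k\<^sub>+\<^sub>1 \<parallel>g\<^sub>k\<parallel>\<^sup>2\<close> in step \<open>k\<close>. The second entry of the step size rule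
  is what makes the remaining quadratic form in \<open>(g\<^sub>k, g\<^sub>k\<^sub>+\<^sub>1)\<close> nonnegative. The energy bounds the
  function value and the summed decrease bounds the gradients. Since every local estimate is at
  most \<open>L\<close>, each step size is at least the minimum of a multiple \<open>\<rho>\<^sub>k > 1\<close> of its predecessor and
  \<open>c\<^sub>k / L\<close>, where \<open>c\<^sub>k \<longlonglongrightarrow> 1/3\<close>.
\<close>

section \<open>Smooth convex functions: gradient, tangent and quadratic bounds, cocoercivity\<close>

lemma L_smooth_gderiv:
  assumes "L_smooth L f"
  shows "GDERIV f x :> gradient f x"
proof -
  from assms have "f differentiable (at x)"
    by (auto simp: L_smooth_def)
  then obtain f' where f': "(f has_derivative f') (at x)"
    by (auto simp: differentiable_def)
  then interpret linear f'
    by (rule has_derivative_linear)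
  \<comment> \<open>Riesz representation: the adjoint at 1 is the vector that represents the
    functional \<open>f'\<close>.\<close>
  have "f' h = h \<bullet> adjoint f' 1" for h
    using adjoint_works[OF linear_axioms, of h 1] by simp
  then have "GDERIV f x :> adjoint f' 1"
    using f' unfolding gderiv_def by (metis ext)
  then show ?thesis
    unfolding gradient_def
  proof (rule theI)
    fix D
    assume "GDERIV f x :> D"
    then have "(\<lambda>h. h \<bullet> D) = f'"
      using f' unfolding gderiv_def by (rule has_derivative_unique)
    then show "D = adjoint f' 1"
      using \<open>\<And>h. f' h = h \<bullet> adjoint f' 1\<close> by (metis vector_eq_ldot)
  qed
qed

lemma L_smooth_line_deriv:
  assumes "L_smooth L f"
  shows "((\<lambda>t. f (u + t *\<^sub>R d)) has_real_derivative gradient f (u + t *\<^sub>R d) \<bullet> d) (at t)"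
proof -
  have "((\<lambda>t. u + t *\<^sub>R d) has_derivative (\<lambda>t. t *\<^sub>R d)) (at t)"
    by (auto intro!: derivative_eq_intros)
  from has_derivative_compose[OF this, of f "\<lambda>h. h \<bullet> gradient f (u + t *\<^sub>R d)"]
  show ?thesis
    using L_smooth_gderiv[OF assms, of "u + t *\<^sub>R d"]
    by (simp add: gderiv_def has_field_derivative_def inner_commute mult.commute[of _ "d \<bullet> _"])
qed

text \<open>Descent lemma: the gap \<open>\<phi>\<close> along the segment from \<open>u\<close> to
  \<open>w\<close> has nonpositive derivative by Cauchy-Schwarz and the Lipschitz bound.\<close>

lemma L_smooth_upper_bound:
  assumes "L_smooth L f"
  shows "f w \<le> f u + gradient f u \<bullet> (w - u) + L / 2 * (norm (w - u))\<^sup>2"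
proof -
  define d where "d = w - u"
  define \<phi> where "\<phi> t = f (u + t *\<^sub>R d) - t * (gradient f u \<bullet> d) - L / 2 * t\<^sup>2 * (norm d)\<^sup>2" for t
  define \<phi>' where "\<phi>' t = gradient f (u + t *\<^sub>R d) \<bullet> d - gradient f u \<bullet> d - L * t * (norm d)\<^sup>2" for t
  have "(\<phi> has_real_derivative \<phi>' t) (at t)" for t
    unfolding \<phi>_def \<phi>'_def by (auto intro!: derivative_eq_intros L_smooth_line_deriv[OF assms])
  moreover have "\<phi>' t \<le> 0" if "0 \<le> t" for t
  proof -
    have "(gradient f (u + t *\<^sub>R d) - gradient f u) \<bullet> d
        \<le> norm (gradient f (u + t *\<^sub>R d) - gradient f u) * norm d"
      by (rule norm_cauchy_schwarz)
    also have "norm (gradient f (u + t *\<^sub>R d) - gradient f u) \<le> L * norm (t *\<^sub>R d)"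
      using assms lipschitz_onD[of L UNIV "gradient f" "u + t *\<^sub>R d" u]
      by (auto simp: L_smooth_def dist_norm)
    finally show ?thesis
      using that by (simp add: \<phi>'_def inner_diff_left power2_eq_square mult_right_mono mult.assoc)
  qed
  ultimately have "\<phi> 1 \<le> \<phi> 0"
    by (intro DERIV_nonpos_imp_nonincreasing[of 0 1 \<phi>]) auto
  then show ?thesis
    by (simp add: \<phi>_def d_def)
qed

lemma convex_L_smooth_above_tangent:
  assumes "L_smooth L f" and "convex_on UNIV f"
  shows "f w \<ge> f v + gradient f v \<bullet> (w - v)"
proof -
  define d where "d = w - v"
  have "convex_on UNIV (\<lambda>t::real. f (v + t *\<^sub>R d))"
  proof (intro convex_onI)
    fix t a b :: real
    assume "0 < t" "t < 1"
    have "v + ((1 - t) *\<^sub>R a + t *\<^sub>R b) *\<^sub>R d = (1 - t) *\<^sub>R (v + a *\<^sub>R d) + t *\<^sub>R (v + b *\<^sub>R d)"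
      by (simp add: algebra_simps)
    then show "f (v + ((1 - t) *\<^sub>R a + t *\<^sub>R b) *\<^sub>R d)
        \<le> (1 - t) * f (v + a *\<^sub>R d) + t * f (v + b *\<^sub>R d)"
      using convex_onD[OF assms(2), of t] \<open>0 < t\<close> \<open>t < 1\<close> by simp
  qed auto
  moreover have "((\<lambda>t::real. f (v + t *\<^sub>R d)) has_real_derivative gradient f v \<bullet> d) (at 0)"
    using L_smooth_line_deriv[OF assms(1), of v d 0] by simp
  ultimately have "f (v + 1 *\<^sub>R d) - f (v + 0 *\<^sub>R d) \<ge> (gradient f v \<bullet> d) * (1 - 0)"
    by (intro convex_on_imp_above_tangent[of UNIV]) auto
  then show ?thesis
    by (simp add: d_def)
qed

lemma convex_L_smooth_cocoercive:
  assumes "L_smooth L f" and "convex_on UNIV f"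
  shows "f u - f v - gradient f v \<bullet> (u - v) \<ge> (norm (gradient f v - gradient f u))\<^sup>2 / (2 * L)"
proof -
  have L: "L > 0"
    using assms(1) by (simp add: L_smooth_def)
  define e where "e = gradient f v - gradient f u"
  \<comment> \<open>This point minimizes the quadratic upper bound at \<open>u\<close> minus the
    tangent plane at \<open>v\<close>; the inequality comes from comparing the two bounds
    there.\<close>
  define w where "w = u + (1 / L) *\<^sub>R e"
  have "f v + gradient f v \<bullet> (w - v) \<le> f u + gradient f u \<bullet> (w - u) + L / 2 * (norm (w - u))\<^sup>2"
    using convex_L_smooth_above_tangent[OF assms, of v w] L_smooth_upper_bound[OF assms(1), of w u]
    by linarith
  moreover have "gradient f v \<bullet> (w - v) - gradient f u \<bullet> (w - u) = gradient f v \<bullet> (u - v) + (norm e)\<^sup>2 / L"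
    using L by (simp add: w_def e_def power2_norm_eq_inner algebra_simps inner_commute
        add_divide_distrib diff_divide_distrib)
  moreover have "L / 2 * (norm (w - u))\<^sup>2 = (norm e)\<^sup>2 / (2 * L)"
    using L by (simp add: w_def power_divide field_simps power2_eq_square)
  moreover have "(norm e)\<^sup>2 / L = 2 * ((norm e)\<^sup>2 / (2 * L))"
    by simp
  ultimately show ?thesis
    unfolding e_def by linarith
qed

text \<open>If the gradients agree, the estimate is 0 whatever its denominator, and its reciprocal
  is infinite. Otherwise cocoercivity gives the denominator a strict sign, so the reciprocal is a
  real number.\<close>

lemma inverse_local_L:
  assumes "L_smooth L f" and "convex_on UNIV f"
  shows "1 / local_L f u v = (if gradient f v = gradient f u then \<infinity>
    else ereal (2 * (f u - f v - gradient f v \<bullet> (u - v)) / (norm (gradient f v - gradient f u))\<^sup>2))"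
proof (cases "gradient f v = gradient f u")
  case True
  then show ?thesis
    by (simp add: local_L_def zero_ereal_def[symmetric] divide_ereal_def)
next
  case False
  define D where "D = f u - f v - gradient f v \<bullet> (u - v)"
  have "L > 0"
    using assms(1) by (simp add: L_smooth_def)
  then have "(norm (gradient f v - gradient f u))\<^sup>2 / (2 * L) > 0"
    using False by simp
  then have D: "D > 0"
    using convex_L_smooth_cocoercive[OF assms, of v u] unfolding D_def by linarith
  have "f v - f u + gradient f v \<bullet> (u - v) = - D"
    by (simp add: D_def)
  then have "local_L f u v = ereal (1 / 2 * (norm (gradient f v - gradient f u))\<^sup>2 / D)"
    using D by (simp add: local_L_def)
  then show ?thesis
    using D False by (simp add: D_def[symmetric] one_ereal_def)
qed

section \<open>The quadratic form in two gradients and the one-step energy inequality\<close>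

text \<open>Completing the square: multiplied by \<open>D = A\<^sup>2 / B\<close>, the form is a
  squared norm plus \<open>E * (h \<bullet> h)\<close>, and \<open>le\<close> makes both summands of
  \<open>E\<close> nonnegative.\<close>

lemma quadratic_form_nonneg:
  fixes g h :: "'a::real_inner"
  assumes "A > 0" "B > 0" "C \<ge> 0" "s > 0" "s' > 0" and le: "C * s \<le> A * s'"
  shows "0 \<le> s\<^sup>2 * (A\<^sup>2 / B + C) * (norm (g - h))\<^sup>2 + 2 * s * s' * A * (g \<bullet> h)
    + B * s'\<^sup>2 * (norm h)\<^sup>2 - C * s\<^sup>2 * (norm g)\<^sup>2 - A * s * s' * (norm h)\<^sup>2"
    (is "0 \<le> ?Q")
proof -
  define D where "D = A\<^sup>2 / B"
  have D: "D > 0" and BD: "B * D = A\<^sup>2"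
    using assms by (auto simp: D_def)
  define p where "p = s * (D + C) - s' * A"
  define E where "E = D * s * (A * s' - C * s) + C * s * (2 * A * s' - C * s)"
  have "0 \<le> A * s'"
    using assms by simp
  then have "C * s \<le> 2 * A * s'"
    using le by linarith
  then have "E \<ge> 0"
    unfolding E_def using assms D
    by (intro add_nonneg_nonneg mult_nonneg_nonneg) auto
  have n: "(norm (g - h))\<^sup>2 = g \<bullet> g - 2 * (g \<bullet> h) + h \<bullet> h"
    by (simp add: power2_norm_eq_inner inner_diff_left inner_diff_right inner_commute)
  have sq: "(norm ((D * s) *\<^sub>R g - p *\<^sub>R h))\<^sup>2
      = (D * s)\<^sup>2 * (g \<bullet> g) - 2 * (D * s * p) * (g \<bullet> h) + p\<^sup>2 * (h \<bullet> h)"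
    unfolding power2_norm_eq_inner
    by (simp add: inner_diff_left inner_diff_right inner_commute power2_eq_square algebra_simps)
  have hh: "D * (s\<^sup>2 * (D + C) + B * s'\<^sup>2 - A * s * s') - p\<^sup>2 = E"
  proof -
    have "D * (s\<^sup>2 * (D + C) + B * s'\<^sup>2 - A * s * s')
        = D * s\<^sup>2 * (D + C) + (B * D) * s'\<^sup>2 - D * A * s * s'"
      by algebra
    then show ?thesis
      unfolding BD p_def E_def by algebra
  qed
  have "D * ?Q = (D * s)\<^sup>2 * (g \<bullet> g) - 2 * (D * s * p) * (g \<bullet> h)
      + D * (s\<^sup>2 * (D + C) + B * s'\<^sup>2 - A * s * s') * (h \<bullet> h)"
    unfolding n D_def[symmetric] power2_norm_eq_inner[of g] power2_norm_eq_inner[of h] p_def by algebra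
  also have "\<dots> = (norm ((D * s) *\<^sub>R g - p *\<^sub>R h))\<^sup>2 + E * (h \<bullet> h)"
    unfolding sq hh[symmetric] by algebra
  also have "\<dots> \<ge> 0"
    using \<open>E \<ge> 0\<close> by simp
  finally show ?thesis
    using D by (simp add: zero_le_mult_iff)
qed

text \<open>
  Here \<open>h\<close>, \<open>g\<close> are the gradients at the consecutive points \<open>u\<close>, \<open>v\<close>, and \<open>C\<close> stands for \<open>B\<^sub>k + a\<^sup>2\<close>
  with \<open>a = \<alpha>\<^sub>k \<tau>\<^sub>k\<close>. Assumption \<open>mom\<close> is the update rule for \<open>v = x\<^sub>k\<close>, a convex combination of
  \<open>y\<^sub>k = u - s' h\<close> and \<open>z = z\<^sub>k\<close>, multiplied by \<open>a \<tau>\<^sub>k\<close>.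
\<close>

lemma energy_step:
  fixes g h u v z w :: "'a::real_inner"
  assumes pos: "A > 0" "B > 0" "C \<ge> 0" "s > 0" "s' > 0" and le: "C * s \<le> A * s'" and "a \<ge> 0"
    and opt: "fw \<ge> fv + g \<bullet> (w - v)"
    and dec: "fu - fv - g \<bullet> (u - v) \<ge> s * (A / B + C / A) / 2 * (norm (g - h))\<^sup>2"
    and mom: "a *\<^sub>R (z - v) = A *\<^sub>R (v - u + s' *\<^sub>R h)"
  shows "s * (A + a) * (fv - fw) + (norm (z - (s * a) *\<^sub>R g - w))\<^sup>2 / 2
      + (C - a\<^sup>2) * s\<^sup>2 * (norm g)\<^sup>2 / 2 + A * s * s' * (norm h)\<^sup>2 / 2
    \<le> s * A * (fu - fw) + (norm (z - w))\<^sup>2 / 2 + B * s'\<^sup>2 * (norm h)\<^sup>2 / 2"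
proof -
  have "(norm (z - (s * a) *\<^sub>R g - w))\<^sup>2
      = (norm (z - w))\<^sup>2 - 2 * (s * a) * (g \<bullet> (z - w)) + (s * a)\<^sup>2 * (norm g)\<^sup>2"
    unfolding power2_norm_eq_inner
    by (simp add: inner_diff_left inner_diff_right inner_commute power2_eq_square algebra_simps)
  \<comment> \<open>\<open>mom\<close> splits the inner product into a term at \<open>v - w\<close>,
    handled by \<open>opt\<close>, a term at \<open>v - u\<close>, handled by \<open>dec\<close>,
    and the cross term of the quadratic form.\<close>
  moreover have "a * (g \<bullet> (z - w)) = a * (g \<bullet> (v - w)) + A * (g \<bullet> (v - u)) + A * s' * (g \<bullet> h)"
  proof -
    have "a * (g \<bullet> (z - v)) = g \<bullet> (A *\<^sub>R (v - u + s' *\<^sub>R h))"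
      unfolding mom[symmetric] by simp
    then show ?thesis
      by (simp add: inner_diff_right inner_add_right algebra_simps)
  qed
  then have "2 * (s * a) * (g \<bullet> (z - w))
      = 2 * (s * a * (g \<bullet> (v - w))) + 2 * (s * A * (g \<bullet> (v - u))) + 2 * s * s' * A * (g \<bullet> h)"
    by algebra
  moreover have "s * a * (fv - fw) \<le> s * a * (g \<bullet> (v - w))"
    using opt pos \<open>a \<ge> 0\<close> by (intro mult_left_mono) (auto simp: inner_diff_right)
  moreover have "s * A * (s * (A / B + C / A) / 2 * (norm (g - h))\<^sup>2) \<le> s * A * (fu - fv + g \<bullet> (v - u))"
    using dec pos by (intro mult_left_mono) (auto simp: inner_diff_right)
  moreover have "s * A * (s * (A / B + C / A) / 2 * (norm (g - h))\<^sup>2)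
      = s\<^sup>2 * (A\<^sup>2 / B + C) * (norm (g - h))\<^sup>2 / 2"
    using pos by (simp add: field_simps power2_eq_square)
  moreover have "s * A * (fu - fv + g \<bullet> (v - u)) = s * A * (fu - fv) + s * A * (g \<bullet> (v - u))"
    by (rule distrib_left)
  moreover note quadratic_form_nonneg[OF pos le, of g h]
  moreover have "(C - a\<^sup>2) * s\<^sup>2 * (norm g)\<^sup>2 = C * s\<^sup>2 * (norm g)\<^sup>2 - (s * a)\<^sup>2 * (norm g)\<^sup>2"
    by algebra
  moreover have "s * (A + a) * (fv - fw) = s * a * (fv - fw) + s * A * (fu - fw) - s * A * (fu - fv)"
    by algebra
  ultimately show ?thesis
    by argo
qed

section \<open>Closed forms and bounds for the parameter sequences\<close>

definition a12 :: "nat \<Rightarrow> real" where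
  "a12 k = (real k + 3)\<^sup>2 / (24 * (real k + 14))"

definition A12 :: "nat \<Rightarrow> real" where
  "A12 k = (real k + 4)\<^sup>2 * (real k + 3) / (288 * (real k + 15))"

lemma tau12_int: "tau12 (int k) = (real k + 14) / 12"
  by (simp add: tau12_def)

lemma tau12_minus_1: "tau12 i - 1 = (of_int i + 2) / 12"
  by (simp add: tau12_def field_simps)

lemma alpha12_int: "alpha12 (int k) = (real k + 3)\<^sup>2 / (2 * (real k + 14)\<^sup>2)"
  unfolding alpha12_def tau12_minus_1 tau12_int by (simp add: power_divide add.commute)

lemma alpha12_tau12: "alpha12 (int k) * tau12 (int k) = a12 k"
  unfolding alpha12_int tau12_int a12_def by (simp add: divide_simps) algebra

lemma A12_eq: "A12 k = a12 (Suc k) * (tau12 (int k + 1) - 1)"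
  unfolding tau12_minus_1 A12_def a12_def by (simp add: add_ac)

lemma adanag_A_12: "adanag_A tau12 alpha12 (int k) = A12 k"
  using alpha12_tau12[of "Suc k"] by (simp add: adanag_A_def A12_eq add.commute)

text \<open>The choice of \<alpha> halves \<open>(tau12 (int k) - 1)\<^sup>2\<close> in the inner
  denominator, so the bracket defining B is 2 - 1. \<open>B0_12\<close> extends the same formula to
  index 0.\<close>

lemma adanag_B_12: "adanag_B tau12 alpha12 B0_12 (int k) = (a12 k)\<^sup>2"
proof -
  have "alpha12 (int k - 1) * (tau12 (int k - 1))\<^sup>2 = (tau12 (int k) - 1)\<^sup>2 / 2"
    by (simp add: alpha12_def tau12_def)
  moreover have "(tau12 (int k) - 1)\<^sup>2 \<noteq> 0"
    unfolding tau12_minus_1 by simp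
  ultimately have "(tau12 (int k) - 1)\<^sup>2 / (alpha12 (int k - 1) * (tau12 (int k - 1))\<^sup>2) = 2"
    by (metis div_by_0 divide_divide_eq_right nonzero_mult_div_cancel_left)
  then have "(alpha12 (int k))\<^sup>2 * (tau12 (int k))\<^sup>2
      * ((tau12 (int k) - 1)\<^sup>2 / (alpha12 (int k - 1) * (tau12 (int k - 1))\<^sup>2) - 1) = (a12 k)\<^sup>2"
    by (simp add: alpha12_tau12[symmetric] power_mult_distrib)
  then show ?thesis
    by (cases "k = 0") (simp_all add: adanag_B_def B0_12_def)
qed

lemma B0_12_eq: "B0_12 = (a12 0)\<^sup>2"
  using adanag_B_12[of 0] by (simp add: adanag_B_def)

text \<open>Since B is the square of \<open>a12\<close>, the numerator of the second fraction in
  \<open>adanag_coeff\<close> becomes \<open>2 * (a12 (Suc k))\<^sup>2\<close>.\<close>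

definition c12 :: "nat \<Rightarrow> real" where
  "c12 k = inverse (A12 k / (a12 k)\<^sup>2 + 2 * (a12 (Suc k))\<^sup>2 / A12 k)"

lemma adanag_coeff_12: "adanag_coeff tau12 alpha12 B0_12 (int k) = c12 k"
proof -
  have "(alpha12 (int k + 1))\<^sup>2 * (tau12 (int k + 1))\<^sup>2 = (a12 (Suc k))\<^sup>2"
    using alpha12_tau12[of "Suc k"] by (simp add: power_mult_distrib[symmetric] add.commute)
  moreover have "adanag_B tau12 alpha12 B0_12 (int k + 1) = (a12 (Suc k))\<^sup>2"
    using adanag_B_12[of "Suc k"] by (simp add: add.commute)
  ultimately show ?thesis
    by (simp add: adanag_coeff_def c12_def adanag_A_12 adanag_B_12)
qed

lemma a12_pos: "a12 k > 0"
  by (simp add: a12_def)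

lemma A12_pos: "A12 k > 0"
  by (simp add: A12_def)

lemma A12_ge: "A12 k \<ge> (real k)\<^sup>2 / 1440"
proof -
  \<comment> \<open>The factor 5 comes from k + 15 \<le> 5 (k + 3), and 1440 = 5 * 288.\<close>
  have "(real k)\<^sup>2 * (real k + 15) \<le> (real k + 4)\<^sup>2 * (5 * (real k + 3))"
    by (intro mult_mono power_mono) auto
  then show ?thesis
    by (simp add: A12_def field_simps)
qed

text \<open>The growth factor in the first entry of the step size rule. The case distinction encodes
  the zero value of A at index -1, where subtraction on naturals would truncate.\<close>

definition rho12 :: "nat \<Rightarrow> real" where
  "rho12 k = ((if k = 0 then 0 else A12 (k - 1)) + a12 k) / A12 k"

lemma rho12_0: "rho12 0 = a12 0 / A12 0"
  by (simp add: rho12_def)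

lemma rho12_pos_index:
  assumes "k > 0"
  shows "rho12 k = (real k + 3) * (real k + 15) / (real k + 4)\<^sup>2"
proof -
  have "A12 (k - 1) = (real k + 3)\<^sup>2 * (real k + 2) / (288 * (real k + 14))"
    using assms by (simp add: A12_def of_nat_diff add.commute)
  moreover have "a12 k = (real k + 3)\<^sup>2 * 12 / (288 * (real k + 14))"
    by (simp add: a12_def divide_simps)
  ultimately have "A12 (k - 1) + a12 k = (real k + 3)\<^sup>2 * (real k + 2 + 12) / (288 * (real k + 14))"
    by (simp only: add_divide_distrib[symmetric] distrib_left[symmetric])
  also have "\<dots> = (real k + 3)\<^sup>2 / 288"
    by (simp add: divide_simps)
  finally have sum: "A12 (k - 1) + a12 k = (real k + 3)\<^sup>2 / 288" .
  have "rho12 k = (A12 (k - 1) + a12 k) / A12 k"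
    using assms by (simp add: rho12_def)
  also have "\<dots> = (real k + 3)\<^sup>2 / 288 / A12 k"
    by (simp only: sum)
  also have "\<dots> = (real k + 3) * (real k + 15) / (real k + 4)\<^sup>2"
    by (simp add: A12_def divide_simps) algebra
  finally show ?thesis .
qed

lemma adanag_rho12:
  "(adanag_A tau12 alpha12 (int k - 1) + alpha12 (int k) * tau12 (int k)) / adanag_A tau12 alpha12 (int k)
    = rho12 k"
proof (cases k)
  case 0
  then show ?thesis
    by (simp add: rho12_def adanag_A_12[of 0, simplified] alpha12_tau12[of 0, simplified])
       (simp add: adanag_A_def)
next
  case (Suc m)
  then show ?thesis
    using adanag_A_12[of m] adanag_A_12[of k] alpha12_tau12[of k]
    by (simp add: rho12_def)
qed

text \<open>For positive \<open>k\<close> this is equality in \<open>rho12_le\<close>; it also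
  identifies the second summand of \<open>inverse (c12 k)\<close>.\<close>

lemma a12_Suc_sq: "2 * (a12 (Suc k))\<^sup>2 * ((real k + 3) * (real k + 15)) = A12 k * (real k + 4)\<^sup>2"
  by (simp add: a12_def A12_def divide_simps add_ac) algebra

text \<open>Together with the first entry of the step size rule this yields assumption
  \<open>le\<close> of \<open>energy_step\<close>.\<close>

lemma rho12_le: "2 * (a12 (Suc k))\<^sup>2 * rho12 k \<le> A12 k"
proof (cases "k = 0")
  case True
  then show ?thesis
    by (simp add: rho12_def a12_def A12_def power2_eq_square)
next
  case False
  then show ?thesis
    using a12_Suc_sq[of k] by (simp add: rho12_pos_index divide_simps)
qed

lemma rho12_ge_1: "rho12 k \<ge> 1"
proof (cases "k = 0")
  case True
  then show ?thesis
    by (simp add: rho12_def a12_def A12_def power2_eq_square)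
next
  case False
  then show ?thesis
    by (simp add: rho12_pos_index divide_simps) (simp add: power2_eq_square algebra_simps)
qed

lemma rho12_ge:
  assumes "k > 0"
  shows "rho12 k \<ge> (real k + 1) / real k"
proof -
  \<comment> \<open>After clearing denominators the two sides of the claim differ by k (21 + 9 k) -
    16.\<close>
  have "1 * 16 \<le> real k * (21 + 9 * real k)"
    using assms by (intro mult_mono) auto
  then have "real k * ((real k + 1) * (real k + 4)\<^sup>2) \<le> real k * (real k * ((real k + 3) * (real k + 15)))"
    by (intro mult_left_mono) (simp_all add: power2_eq_square algebra_simps)
  then show ?thesis
    using assms by (simp add: rho12_pos_index divide_simps) (simp add: mult_ac)
qed

lemma c12_inverse:
  "inverse (c12 k) = 2 * (real k + 4)\<^sup>2 * (real k + 14)\<^sup>2 / ((real k + 15) * (real k + 3) ^ 3)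
     + (real k + 4)\<^sup>2 / ((real k + 3) * (real k + 15))"
proof -
  have "A12 k / (a12 k)\<^sup>2 = 2 * (real k + 4)\<^sup>2 * (real k + 14)\<^sup>2 / ((real k + 15) * (real k + 3) ^ 3)"
    by (simp add: a12_def A12_def divide_simps) algebra
  moreover have "2 * (a12 (Suc k))\<^sup>2 / A12 k = (real k + 4)\<^sup>2 / ((real k + 3) * (real k + 15))"
    using a12_Suc_sq[of k] A12_pos[of k] by (simp add: divide_simps)
  ultimately show ?thesis
    by (simp add: c12_def)
qed

lemma c12_pos: "c12 k > 0"
  unfolding c12_def using A12_pos[of k] a12_pos[of k] a12_pos[of "Suc k"]
  by (simp add: add_pos_pos)

text \<open>The 18 is 17 + 1, one bound for each summand in \<open>c12_inverse\<close>.\<close>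

lemma c12_ge: "c12 k \<ge> 1 / 18"
proof -
  have "2 * (real k + 4)\<^sup>2 * (real k + 14)\<^sup>2 / ((real k + 15) * (real k + 3) ^ 3) \<le> 17"
    by (simp add: divide_simps) (simp add: power2_eq_square power3_eq_cube algebra_simps)
  moreover have "(real k + 4)\<^sup>2 / ((real k + 3) * (real k + 15)) \<le> 1"
    by (simp add: divide_simps) (simp add: power2_eq_square algebra_simps)
  ultimately have "inverse (c12 k) \<le> 18"
    unfolding c12_inverse by linarith
  then show ?thesis
    using c12_pos[of k] by (simp add: divide_simps)
qed

text \<open>The two summands in \<open>c12_inverse\<close> tend to 2 and 1.\<close>

lemma c12_tendsto: "c12 \<longlonglongrightarrow> 1 / 3"
proof -
  have "(\<lambda>k. inverse (c12 k)) \<longlonglongrightarrow> 3"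
    unfolding c12_inverse by real_asymp
  from tendsto_inverse[OF this] show ?thesis
    by simp
qed

section \<open>A run of the algorithm: recurrences and lower bounds on the step sizes\<close>

locale adanag_12 =
  fixes f :: "'a::euclidean_space \<Rightarrow> real" and L :: real and w :: 'a
    and x y z :: "nat \<Rightarrow> 'a" and s :: "nat \<Rightarrow> real"
  assumes smooth: "L_smooth L f" and conv: "convex_on UNIV f" and minimizer: "f w \<le> f u"
    and run: "adanag_G f tau12 alpha12 B0_12 x y z s" and s0_pos: "s 0 > 0"
begin

abbreviation g :: "nat \<Rightarrow> 'a" where "g k \<equiv> gradient f (x k)"

abbreviation R :: real where "R \<equiv> R12 f L (s 0) (x 0) w"

lemma L_pos: "L > 0"
  using smooth by (simp add: L_smooth_def)

lemma z_Suc: "z (Suc k) = z k - (s k * a12 k) *\<^sub>R g k"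
  using run by (simp add: adanag_G_def alpha12_tau12 mult.assoc)

lemma x_Suc:
  "x (Suc k) = (1 - 1 / tau12 (int k + 1)) *\<^sub>R (x k - s k *\<^sub>R g k)
    + (1 / tau12 (int k + 1)) *\<^sub>R z (Suc k)"
  using run by (simp add: adanag_G_def)

text \<open>Multiplying the update of x by \<tau> clears its weights, and
  \<open>a12 (Suc k) * (\<tau> - 1)\<close> is \<open>A12 k\<close>. This is assumption
  \<open>mom\<close> of \<open>energy_step\<close>.\<close>

lemma momentum: "a12 (Suc k) *\<^sub>R (z (Suc k) - x (Suc k)) = A12 k *\<^sub>R (x (Suc k) - x k + s k *\<^sub>R g k)"
proof -
  define \<tau> where "\<tau> = tau12 (int k + 1)"
  have \<tau>: "\<tau> > 0"
    by (simp add: \<tau>_def tau12_def)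
  have A: "A12 k = a12 (Suc k) * (\<tau> - 1)"
    by (simp add: A12_eq \<tau>_def)
  have "\<tau> *\<^sub>R x (Suc k) = (\<tau> * (1 - 1 / \<tau>)) *\<^sub>R (x k - s k *\<^sub>R g k) + (\<tau> * (1 / \<tau>)) *\<^sub>R z (Suc k)"
    unfolding x_Suc \<tau>_def[symmetric] by (simp add: scaleR_add_right)
  also have "\<tau> * (1 - 1 / \<tau>) = \<tau> - 1"
    using \<tau> by (simp add: field_simps)
  finally have "z (Suc k) = \<tau> *\<^sub>R x (Suc k) - (\<tau> - 1) *\<^sub>R (x k - s k *\<^sub>R g k)"
    using \<tau> by simp
  then have "z (Suc k) - x (Suc k) = (\<tau> - 1) *\<^sub>R (x (Suc k) - x k + s k *\<^sub>R g k)"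
    by (simp add: algebra_simps)
  then show ?thesis
    by (simp add: A)
qed

lemma s_Suc: "ereal (s (Suc k))
    = min (ereal (rho12 k * s k)) (ereal (c12 k) * (1 / local_L f (x k) (x (Suc k))))"
  using run by (simp add: adanag_G_def adanag_rho12 adanag_coeff_12 add.commute)

lemma s_Suc_le: "s (Suc k) \<le> rho12 k * s k"
  using s_Suc[of k] by (metis ereal_less_eq(3) min.cobounded1)

text \<open>Cocoercivity says that the local estimate is at most \<open>L\<close>; for equal
  gradients the second entry is infinite.\<close>

lemma s_Suc_ge: "s (Suc k) \<ge> min (rho12 k * s k) (c12 k / L)"
proof -
  have "ereal (c12 k / L) \<le> ereal (c12 k) * (1 / local_L f (x k) (x (Suc k)))"
  proof (cases "g (Suc k) = g k")
    case True
    then show ?thesis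
      using c12_pos[of k] by (simp add: inverse_local_L[OF smooth conv])
  next
    case False
    then have "1 / L \<le> 2 * (f (x k) - f (x (Suc k)) - g (Suc k) \<bullet> (x k - x (Suc k)))
        / (norm (g (Suc k) - g k))\<^sup>2"
      using L_pos convex_L_smooth_cocoercive[OF smooth conv, of "x (Suc k)" "x k"]
      by (simp add: field_simps)
    then have "c12 k * (1 / L) \<le> c12 k * (2 * (f (x k) - f (x (Suc k))
        - g (Suc k) \<bullet> (x k - x (Suc k))) / (norm (g (Suc k) - g k))\<^sup>2)"
      using c12_pos[of k] by (intro mult_left_mono) auto
    then show ?thesis
      using False by (simp add: inverse_local_L[OF smooth conv])
  qed
  then have "ereal (min (rho12 k * s k) (c12 k / L)) \<le> ereal (s (Suc k))"
    unfolding s_Suc by (intro min.boundedI) (auto simp del: ereal_min intro: order_trans[rotated])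
  then show ?thesis
    by (simp only: ereal_less_eq)
qed

text \<open>The second entry of the step size rule, solved for the function decrease; this is
  assumption \<open>dec\<close> of \<open>energy_step\<close>.\<close>

lemma decrease: "f (x k) - f (x (Suc k)) - g (Suc k) \<bullet> (x k - x (Suc k))
    \<ge> s (Suc k) * inverse (c12 k) / 2 * (norm (g (Suc k) - g k))\<^sup>2"
proof (cases "g (Suc k) = g k")
  case True
  then show ?thesis
    using convex_L_smooth_above_tangent[OF smooth conv, of "x (Suc k)" "x k"] by simp
next
  case False
  have "ereal (s (Suc k)) \<le> ereal (c12 k) * (1 / local_L f (x k) (x (Suc k)))"
    unfolding s_Suc by simp
  then show ?thesis
    using False c12_pos[of k] by (simp add: inverse_local_L[OF smooth conv] field_simps)
qed

lemma s_pos: "s k > 0"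
proof (induction k)
  case (Suc k)
  have "rho12 k * s k > 0"
    using rho12_ge_1[of k] Suc by simp
  then have "min (rho12 k * s k) (c12 k / L) > 0"
    using c12_pos[of k] L_pos by simp
  then show ?case
    using s_Suc_ge[of k] by linarith
qed (rule s0_pos)

text \<open>The first entry preserves the threshold because \<open>rho12 k\<close> is at least 1,
  the second because \<open>c12 k\<close> is at least \<open>c\<close>.\<close>

lemma s_ge:
  assumes "s 0 \<ge> c / L" and "\<And>k. c12 k \<ge> c"
  shows "s k \<ge> c / L"
proof (induction k)
  case (Suc k)
  have "s k \<le> rho12 k * s k"
    using rho12_ge_1[of k] s_pos[of k] by simp
  moreover have "c12 k / L \<ge> c / L"
    using assms(2) L_pos by (simp add: divide_right_mono)
  ultimately show ?case
    using s_Suc_ge[of k] Suc by linarith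
qed (rule assms)

text \<open>
  The growth factors are at least \<open>(k + 1) / k\<close>, so the step sizes grow at least linearly until they
  reach \<open>m / L\<close>.
\<close>

lemma eventually_s_ge:
  assumes "m < 1 / 3"
  shows "eventually (\<lambda>k. s k \<ge> m / L) sequentially"
proof -
  have "eventually (\<lambda>k. c12 k > m) sequentially"
    using order_tendstoD(1)[OF c12_tendsto assms] .
  then obtain K where K: "\<And>k. k \<ge> K \<Longrightarrow> c12 k > m"
    by (auto simp: eventually_sequentially)
  \<comment> \<open>The successor makes \<open>N\<close> positive; \<open>d\<close> is then the
    slope of the line through the origin that meets the step size at \<open>N\<close>.\<close>
  define N where "N = Suc K"
  define d where "d = s N / real N"
  have d: "d > 0"
    using s_pos[of N] by (simp add: d_def N_def)
  have *: "s k \<ge> min (d * real k) (m / L)" if "k \<ge> N" for k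
    using that
  proof (induction k rule: dec_induct)
    case base
    show ?case
      by (simp add: d_def N_def)
  next
    case (step k)
    have k: "k > 0" "k \<ge> K"
      using step by (auto simp: N_def)
    have r: "(real k + 1) / real k \<le> rho12 k"
      using rho12_ge k by simp
    have "min (d * real (Suc k)) (m / L) \<le> rho12 k * s k"
    proof (cases "d * real k \<le> m / L")
      case True
      then have "d * real k \<le> s k"
        using step by simp
      then have "(real k + 1) / real k * (d * real k) \<le> rho12 k * s k"
        using r d s_pos[of k] k rho12_ge_1[of k] by (intro mult_mono) auto
      moreover have "(real k + 1) / real k * (d * real k) = d * real (Suc k)"
        using k by (simp add: field_simps)
      ultimately show ?thesis
        by linarith
    next
      case False
      then have "m / L \<le> s k"
        using step by simp
      also have "s k \<le> rho12 k * s k"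
        using rho12_ge_1[of k] s_pos[of k] by simp
      finally show ?thesis
        by linarith
    qed
    moreover have "m / L \<le> c12 k / L"
      using K[OF k(2)] L_pos by (simp add: divide_right_mono)
    ultimately show ?case
      using s_Suc_ge[of k] by linarith
  qed
  have "filterlim (\<lambda>k. d * real k) at_top sequentially"
    using d by real_asymp
  then have "eventually (\<lambda>k. d * real k \<ge> m / L) sequentially"
    by (simp add: filterlim_at_top)
  then show ?thesis
    using eventually_ge_at_top[of N]
  proof eventually_elim
    case (elim k)
    then show ?case
      using *[of k] by linarith
  qed
qed

text \<open>\<open>eventually_s_ge\<close> covers only m < 1/3, so it is applied with m = 1/3 - e L
  for arbitrary e > 0.\<close>

lemma liminf_s_ge: "liminf (\<lambda>k. ereal (s k)) \<ge> ereal (1 / 3 * (1 / L))"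
proof (rule ereal_le_epsilon2)
  fix e :: real
  assume "e > 0"
  then have "eventually (\<lambda>k. s k \<ge> (1 / 3 - e * L) / L) sequentially"
    using L_pos by (intro eventually_s_ge) auto
  then have "eventually (\<lambda>k. ereal (1 / 3 * (1 / L) - e) \<le> ereal (s k)) sequentially"
    using L_pos by (simp add: diff_divide_distrib)
  then have "ereal (1 / 3 * (1 / L) - e) \<le> liminf (\<lambda>k. ereal (s k))"
    by (rule Liminf_bounded)
  then show "ereal (1 / 3 * (1 / L)) \<le> liminf (\<lambda>k. ereal (s k)) + ereal e"
    by (simp add: ereal_minus_le ereal_minus(1)[symmetric] del: ereal_minus(1))
qed

section \<open>The energy along a run and its decrease\<close>

definition energy :: "nat \<Rightarrow> real" where
  "energy k = s (Suc k) * A12 k * (f (x k) - f w) + (norm (z (Suc k) - w))\<^sup>2 / 2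
     + (a12 k)\<^sup>2 * (s k)\<^sup>2 * (norm (g k))\<^sup>2 / 2"

text \<open>Cocoercivity at the minimizer, where the gradient vanishes, supplies a negative multiple
  of the squared norm of \<open>g 0\<close>; \<open>R / 2\<close> retains half of it.\<close>

lemma energy_0: "energy 0 \<le> R / 2"
proof -
  define t where "t = s 0 * a12 0"
  have t: "t > 0"
    using s0_pos a12_pos[of 0] by (simp add: t_def)
  \<comment> \<open>The first entry of the step size rule, with A equal to 0 at index -1.\<close>
  have "s 1 * A12 0 \<le> t"
    using s_Suc_le[of 0] A12_pos[of 0] by (simp add: rho12_0 t_def field_simps)
  then have 1: "s 1 * A12 0 * (f (x 0) - f w) \<le> t * (f (x 0) - f w)"
    using minimizer[of "x 0"] by (intro mult_right_mono) auto
  have "gradient f w = 0"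
  proof -
    have "GDERIV f w :> gradient f w"
      by (rule L_smooth_gderiv[OF smooth])
    then have "(\<lambda>h. h \<bullet> gradient f w) = (\<lambda>h. 0)"
      unfolding gderiv_def
      by (intro differential_zero_maxmin[of w UNIV f]) (auto simp: minimizer)
    then have "gradient f w \<bullet> gradient f w = 0"
      by metis
    then show ?thesis by simp
  qed
  then have "f w - f (x 0) - g 0 \<bullet> (w - x 0) \<ge> (norm (g 0))\<^sup>2 / (2 * L)"
    using convex_L_smooth_cocoercive[OF smooth conv, of "x 0" w] by simp
  then have "t * (f w - f (x 0) - g 0 \<bullet> (w - x 0)) \<ge> t * ((norm (g 0))\<^sup>2 / (2 * L))"
    using t by (intro mult_left_mono) auto
  then have 2: "t * (f (x 0) - f w) - t * (g 0 \<bullet> (x 0 - w)) \<le> - (t / (2 * L) * (norm (g 0))\<^sup>2)"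
    by (simp add: algebra_simps)
  have "z 0 = x 0"
    using run by (simp add: adanag_G_def)
  then have z1: "z 1 - w = (x 0 - w) - t *\<^sub>R g 0"
    using z_Suc[of 0] by (simp add: t_def)
  have z: "(norm (z 1 - w))\<^sup>2 = (norm (x 0 - w))\<^sup>2 - 2 * (t * (g 0 \<bullet> (x 0 - w))) + t\<^sup>2 * (norm (g 0))\<^sup>2"
    unfolding z1 power2_norm_eq_inner
    by (simp add: inner_diff_left inner_diff_right inner_commute power2_eq_square algebra_simps)
  have "R = (norm (x 0 - w))\<^sup>2 + 2 * (t\<^sup>2 * (norm (g 0))\<^sup>2) - t / (2 * L) * (norm (g 0))\<^sup>2"
    using alpha12_tau12[of 0] by (simp add: R12_def B0_12_eq t_def power_mult_distrib[symmetric])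
      (simp add: algebra_simps power2_eq_square)
  moreover have "t / (2 * L) * (norm (g 0))\<^sup>2 \<ge> 0"
    using t L_pos by simp
  moreover have "energy 0 = s 1 * A12 0 * (f (x 0) - f w) + (norm (z 1 - w))\<^sup>2 / 2
      + t\<^sup>2 * (norm (g 0))\<^sup>2 / 2"
    by (simp add: energy_def t_def power_mult_distrib)
  ultimately show ?thesis
    using 1 2 z by linarith
qed

lemma energy_Suc: "energy (Suc k) + A12 k * s k * s (Suc k) * (norm (g k))\<^sup>2 / 2 \<le> energy k"
proof -
  define C where "C = 2 * (a12 (Suc k))\<^sup>2"
  have "C * s (Suc k) \<le> C * (rho12 k * s k)"
    using s_Suc_le[of k] by (intro mult_left_mono) (auto simp: C_def)
  also have "\<dots> \<le> A12 k * s k"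
    using rho12_le[of k] s_pos[of k] by (simp add: C_def mult_right_mono mult.assoc[symmetric])
  finally have le: "C * s (Suc k) \<le> A12 k * s k" .
  have "s (Suc k) * (A12 k + a12 (Suc k)) * (f (x (Suc k)) - f w)
      + (norm (z (Suc k) - (s (Suc k) * a12 (Suc k)) *\<^sub>R g (Suc k) - w))\<^sup>2 / 2
      + (C - (a12 (Suc k))\<^sup>2) * (s (Suc k))\<^sup>2 * (norm (g (Suc k)))\<^sup>2 / 2
      + A12 k * s (Suc k) * s k * (norm (g k))\<^sup>2 / 2
    \<le> s (Suc k) * A12 k * (f (x k) - f w) + (norm (z (Suc k) - w))\<^sup>2 / 2
      + (a12 k)\<^sup>2 * (s k)\<^sup>2 * (norm (g k))\<^sup>2 / 2"
  proof (rule energy_step)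
    show "s (Suc k) * (A12 k / (a12 k)\<^sup>2 + C / A12 k) / 2 * (norm (g (Suc k) - g k))\<^sup>2
        \<le> f (x k) - f (x (Suc k)) - g (Suc k) \<bullet> (x k - x (Suc k))"
      using decrease[of k] by (simp add: c12_def C_def)
  qed (use A12_pos a12_pos s_pos le momentum convex_L_smooth_above_tangent[OF smooth conv]
      in \<open>auto simp: C_def less_imp_le less_imp_neq[THEN not_sym]\<close>)
  \<comment> \<open>The step size rule one index later turns the weight of the function gap into the
    one in the next energy.\<close>
  moreover have "s (Suc (Suc k)) * A12 (Suc k) \<le> s (Suc k) * (A12 k + a12 (Suc k))"
    using s_Suc_le[of "Suc k"] A12_pos[of "Suc k"] by (simp add: rho12_def field_simps)
  then have "s (Suc (Suc k)) * A12 (Suc k) * (f (x (Suc k)) - f w)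
      \<le> s (Suc k) * (A12 k + a12 (Suc k)) * (f (x (Suc k)) - f w)"
    using minimizer by (intro mult_right_mono) auto
  moreover have "C - (a12 (Suc k))\<^sup>2 = (a12 (Suc k))\<^sup>2"
    by (simp add: C_def)
  ultimately show ?thesis
    unfolding energy_def z_Suc[of "Suc k"] by (simp add: mult.assoc mult.left_commute)
qed

lemma energy_sum: "energy k + (\<Sum>i<k. A12 i * s i * s (Suc i) * (norm (g i))\<^sup>2 / 2) \<le> R / 2"
proof (induction k)
  case 0
  then show ?case
    using energy_0 by simp
next
  case (Suc k)
  then show ?case
    using energy_Suc[of k] by simp
qed

lemma energy_ge: "energy k \<ge> s (Suc k) * A12 k * (f (x k) - f w)"
  by (simp add: energy_def)

lemma energy_nonneg: "energy k \<ge> 0"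
  using energy_ge[of k] s_pos[of "Suc k"] A12_pos[of k] minimizer[of "x k"]
  by (smt (verit) mult_nonneg_nonneg)

lemma R_nonneg: "R \<ge> 0"
  using energy_nonneg[of 0] energy_0 by linarith

section \<open>Convergence rates and their constants\<close>

lemma value_bound: "f (x k) - f w \<le> R / (2 * s (Suc k) * A12 k)"
proof -
  have "(\<Sum>i<k. A12 i * s i * s (Suc i) * (norm (g i))\<^sup>2 / 2) \<ge> 0"
    using A12_pos s_pos by (intro sum_nonneg) (simp add: less_imp_le)
  then have "s (Suc k) * A12 k * (f (x k) - f w) \<le> R / 2"
    using energy_ge[of k] energy_sum[of k] by linarith
  then show ?thesis
    using s_pos[of "Suc k"] A12_pos[of k] by (simp add: field_simps)
qed

text \<open>The minimum is pulled out of the summed decrease. The weights are at least i^2 / 1440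
  and the squares sum to at least k^3 / 3, whence 4320 = 3 * 1440.\<close>

lemma gradient_bound:
  assumes "c > 0" and c: "\<And>i. s i \<ge> c / L" and "k \<ge> 1"
  shows "(MIN i\<in>{1..k}. (norm (g i))\<^sup>2) \<le> 4320 / c\<^sup>2 * R * (L\<^sup>2 / real k ^ 3)"
proof -
  define m where "m = (MIN i\<in>{1..k}. (norm (g i))\<^sup>2)"
  have m: "m \<le> (norm (g i))\<^sup>2" if "i \<in> {1..k}" for i
    unfolding m_def using that by (intro Min_le) auto
  have "m \<ge> 0"
    unfolding m_def using \<open>k \<ge> 1\<close> by (subst Min_ge_iff) auto
  have cL: "c / L > 0"
    using assms L_pos by simp
  have squares: "(\<Sum>i=1..n. (real i)\<^sup>2) \<ge> real n ^ 3 / 3" for n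
    by (induction n) (auto simp: power2_eq_square power3_eq_cube algebra_simps)
  have "c\<^sup>2 / L\<^sup>2 * m * (real k ^ 3 / 4320) = (c / L)\<^sup>2 * m * (real k ^ 3 / 3) / 1440"
    by (simp add: power_divide)
  also have "\<dots> \<le> (c / L)\<^sup>2 * m * (\<Sum>i=1..k. (real i)\<^sup>2) / 1440"
    using squares[of k] \<open>m \<ge> 0\<close> by (intro divide_right_mono mult_left_mono) auto
  also have "\<dots> = (\<Sum>i=1..k. (real i)\<^sup>2 / 1440 * (c / L) * (c / L) * m)"
    by (simp add: sum_distrib_left sum_divide_distrib power2_eq_square mult_ac)
  also have "\<dots> \<le> (\<Sum>i=1..k. A12 i * s i * s (Suc i) * (norm (g i))\<^sup>2)"
    using A12_ge c cL m \<open>m \<ge> 0\<close> A12_pos s_pos by (intro sum_mono mult_mono) (auto simp: less_imp_le)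
  \<comment> \<open>Adds the nonnegative term at index 0, to match
    \<open>energy_sum\<close>.\<close>
  also have "\<dots> \<le> (\<Sum>i<Suc k. A12 i * s i * s (Suc i) * (norm (g i))\<^sup>2)"
    using A12_pos s_pos by (intro sum_mono2) (auto simp: less_imp_le)
  also have "\<dots> = 2 * (\<Sum>i<Suc k. A12 i * s i * s (Suc i) * (norm (g i))\<^sup>2 / 2)"
    by (simp add: sum_divide_distrib[symmetric])
  also have "\<dots> \<le> R"
    using energy_sum[of "Suc k"] energy_nonneg[of "Suc k"] by linarith
  finally show ?thesis
    unfolding m_def[symmetric] using assms L_pos by (simp add: field_simps)
qed

end

text \<open>\<open>C\<close> is chosen before the function and the run, so the constants of both
  O-terms depend on \<open>r\<close> alone. The bound 1/250 carries a premise because a small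
  \<open>r\<close> can make \<open>s 0\<close> smaller than that.\<close>

theorem corollary7:
  fixes r :: real
  assumes "r > 0"
    and "\<forall>k::nat. adanag_coeff tau12 alpha12 B0_12 (int k) \<ge> r / alpha12 (int k + 1)"
  shows "\<exists>C>0. \<forall>(f :: 'a::euclidean_space \<Rightarrow> real) L xstar xt0 L0 x y z s.
    L_smooth L f \<longrightarrow> convex_on UNIV f \<longrightarrow> (\<forall>u. f xstar \<le> f u) \<longrightarrow>
    x 0 \<noteq> xt0 \<longrightarrow>
    L0 = norm (gradient f (x 0) - gradient f xt0) / norm (x 0 - xt0) \<longrightarrow> L0 > 0 \<longrightarrow>
    s 0 = adanag_A tau12 alpha12 0 / (alpha12 0 * tau12 0) * (r / alpha12 1) * (1 / L0) \<longrightarrow>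
    adanag_G f tau12 alpha12 B0_12 x y z s \<longrightarrow>
      (\<forall>k::nat. f (x k) - f xstar
          \<le> 1 / s (k + 1) * (144 * (real k + 15) / ((real k + 3) * (real k + 4)\<^sup>2))
            * R12 f L (s 0) (x 0) xstar) \<and>
      (\<forall>k\<ge>1. f (x k) - f xstar \<le> C * R12 f L (s 0) (x 0) xstar * (L / (real k)\<^sup>2)) \<and>
      (\<forall>k\<ge>1. (MIN i\<in>{1..k}. (norm (gradient f (x i)))\<^sup>2)
          \<le> C * R12 f L (s 0) (x 0) xstar * (L\<^sup>2 / (real k) ^ 3)) \<and>
      (1 / 250 \<le> adanag_A tau12 alpha12 0 / (alpha12 0 * tau12 0) * (r / alpha12 1) \<longrightarrow>
          (\<forall>k. s k \<ge> 1 / 250 * (1 / L))) \<and>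
      liminf (\<lambda>k. ereal (s k)) \<ge> ereal (1 / 3 * (1 / L))"
proof -
  define b where "b = adanag_A tau12 alpha12 0 / (alpha12 0 * tau12 0) * (r / alpha12 1)"
  have b: "b > 0"
    using \<open>r > 0\<close> A12_pos[of 0] a12_pos[of 0] adanag_A_12[of 0] alpha12_tau12[of 0] alpha12_int[of 1]
    by (simp add: b_def)
  \<comment> \<open>\<open>c / L\<close> bounds all step sizes from below: \<open>b\<close> accounts
    for \<open>s 0\<close>, and 1/18 for all \<open>c12 k\<close>.\<close>
  define c where "c = min b (1 / 18)"
  have c: "c > 0" "c \<le> b" "c \<le> 1 / 18"
    using b by (auto simp: c_def)
  \<comment> \<open>720 is 1440 / 2, from \<open>A12_ge\<close> and the 2 in
    \<open>value_bound\<close>; the other entry is from \<open>gradient_bound\<close>.\<close>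
  define C where "C = max (720 / c) (4320 / c\<^sup>2)"
  have C: "C > 0" "720 / c \<le> C" "4320 / c\<^sup>2 \<le> C"
    using c by (auto simp: C_def less_max_iff_disj)
  show ?thesis
  proof (intro exI[of _ C] conjI[OF C(1)] allI impI, goal_cases)
    case (1 f L xstar xt0 L0 x y z s)
    have s0: "s 0 = b / L0"
      using 1(7) by (simp add: b_def)
    interpret adanag_12 f L xstar x y z s
    proof
      show "s 0 > 0"
        using b \<open>L0 > 0\<close> by (simp add: s0)
    qed (use 1 in blast)+
    \<comment> \<open>\<open>L0\<close> is a difference quotient of the gradient.\<close>
    have "L0 \<le> L"
      using 1 lipschitz_onD[of L UNIV "gradient f" "x 0" xt0]
      by (simp add: L_smooth_def dist_norm divide_le_eq)
    then have s0_ge: "s 0 \<ge> b / L"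
      using b \<open>L0 > 0\<close> by (simp add: s0 frac_le)
    \<comment> \<open>Used with \<open>c\<close> for the rates and with 1/250 for the explicit step
      size bound.\<close>
    have s_ge': "s k \<ge> d / L" if "d \<le> b" "d \<le> 1 / 18" for d k
    proof (rule s_ge)
      have "d / L \<le> b / L"
        using that L_pos by (simp add: divide_right_mono)
      then show "d / L \<le> s 0"
        using s0_ge by linarith
    qed (use that c12_ge order_trans in blast)
    show ?case
    proof (intro conjI allI impI, goal_cases)
      case (1 k)
      have "R / (2 * s (Suc k) * A12 k)
          = 1 / s (k + 1) * (144 * (real k + 15) / ((real k + 3) * (real k + 4)\<^sup>2)) * R"
        using s_pos[of "Suc k"] by (simp add: A12_def divide_simps)
      then show ?case
        using value_bound[of k] by simp
    next
      case (2 k)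
      have "2 * (c / L) * ((real k)\<^sup>2 / 1440) \<le> 2 * s (Suc k) * A12 k"
        using s_ge'[OF c(2,3), of "Suc k"] A12_ge[of k] c L_pos s_pos[of "Suc k"]
        by (intro mult_mono) auto
      then have "R / (2 * s (Suc k) * A12 k) \<le> R / (2 * (c / L) * ((real k)\<^sup>2 / 1440))"
        using 2 R_nonneg c L_pos A12_pos[of k] s_pos[of "Suc k"] by (intro divide_left_mono) auto
      also have "\<dots> = 720 / c * R * (L / (real k)\<^sup>2)"
        by simp
      also have "\<dots> \<le> C * R * (L / (real k)\<^sup>2)"
        using C R_nonneg L_pos by (intro mult_right_mono) auto
      finally show ?case
        using value_bound[of k] by simp
    next
      case (3 k)
      have "4320 / c\<^sup>2 * R * (L\<^sup>2 / real k ^ 3) \<le> C * R * (L\<^sup>2 / real k ^ 3)"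
        using C R_nonneg by (intro mult_right_mono) auto
      then show ?case
        using gradient_bound[OF c(1) s_ge'[OF c(2,3)], of k] 3 by linarith
    next
      case (4 k)
      then show ?case
        using s_ge'[of "1 / 250" k] by (simp add: b_def)
    next
      case 5
      show ?case by (rule liminf_s_ge)
    qed
  qed
qed

end
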